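(* There exists an absolute constant $c>1$ such that the following holds. Let $1\le m\le n$ be integers, let $\mu$ be a measure on $\mathbb{R}^n$ given by $d\mu(x)=\phi(x)\,dx$, where $\phi\colon\mathbb{R}^n\to[0,\infty)$ is radially decreasing, and let $H\subset\mathbb{R}^n$ be an $m$-dimensional linear subspace. Then for any convex body $K\subset\mathbb{R}^n$, $$\mu((K-K)\cap H)\le\binom{n+m}{m}\sup_{y\in\mathbb{R}^n}\mu((K-y)\cap H)\le\left[\frac{cn}{m}\right]^m\sup_{y\in\mathbb{R}^n}\mu((K-y)\cap H).$$
   Context: A convex body is a compact convex subset of $\mathbb{R}^n$ with non-empty interior; $K-K=\{a-b:a,b\in K\}$. A function $\phi$ is radially decreasing if $\phi(tx)\ge\phi(x)$ for all $t\in[0,1]$, $x\in\mathbb{R}^n$. If $\mu$ has (Borel) density $\phi$ and $H$ is a linear subspace, then $\mu(A\cap H)=\int_H\phi(x)\chi_A(x)\,dx$ with $dx$ Lebesgue measure on $H$. *)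

theory Defs
  imports "HOL-Analysis.Analysis" "HOL-Library.Function_Algebras"
begin

text \<open>
  The dimension has to be quantified inside the statement (the constant does not depend on it),
  so \<open>\<real>\<^sup>n\<close> is the carrier of the library topology \<^const>\<open>Euclidean_space\<close>, i.e. the set of
  sequences \<open>nat \<Rightarrow> real\<close> vanishing at all indices \<open>\<ge> n\<close>, with the topology of pointwise
  convergence. The pointwise real vector space structure below gives access to the library's
  \<^const>\<open>convex\<close>, \<^const>\<open>subspace\<close>, \<^const>\<open>span\<close> and \<^const>\<open>dim\<close>.
\<close>

instantiation "fun" :: (type, real_vector) real_vector
begin

definition scaleR_fun_def: "r *\<^sub>R f = (\<lambda>x. r *\<^sub>R f x)"

instance
  by standard (simp_all add: scaleR_fun_def fun_eq_iff scaleR_add_right scaleR_add_left)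

end

lemma scaleR_fun_apply [simp]: "(r *\<^sub>R f) x = r *\<^sub>R f x"
  by (simp add: scaleR_fun_def)

abbreviation Rn :: "nat \<Rightarrow> (nat \<Rightarrow> real) set"
  where "Rn n \<equiv> topspace (Euclidean_space n)"

definition convex_body :: "nat \<Rightarrow> (nat \<Rightarrow> real) set \<Rightarrow> bool"
  where "convex_body n K \<longleftrightarrow>
    compactin (Euclidean_space n) K \<and> convex K \<and> Euclidean_space n interior_of K \<noteq> {}"

definition radially_decreasing :: "nat \<Rightarrow> ((nat \<Rightarrow> real) \<Rightarrow> real) \<Rightarrow> bool"
  where "radially_decreasing n \<phi> \<longleftrightarrow> (\<forall>x\<in>Rn n. \<forall>t\<in>{0..1}. \<phi> (t *\<^sub>R x) \<ge> \<phi> x)"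

definition orthonormal_basis_of ::
    "nat \<Rightarrow> (nat \<Rightarrow> real) set \<Rightarrow> (nat \<Rightarrow> nat \<Rightarrow> real) \<Rightarrow> bool"
  where "orthonormal_basis_of n H u \<longleftrightarrow>
    (\<forall>i<dim H. u i \<in> Rn n) \<and>
    (\<forall>i<dim H. \<forall>j<dim H. (\<Sum>k<n. u i k * u j k) = (if i = j then 1 else 0)) \<and>
    span (u ` {..<dim H}) = H"

text \<open>
  Lebesgue measure on a linear subspace \<open>H\<close> of \<open>\<real>\<^sup>n\<close>, as a Borel measure with space \<open>H\<close>: the image
  of Lebesgue measure on \<open>\<real>\<^sup>m\<close>, \<open>m = dim H\<close>, under the linear isometry given by an orthonormal basis
  of \<open>H\<close>. The choice of the basis is immaterial because Lebesgue measure on \<open>\<real>\<^sup>m\<close> is invariant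
  under orthogonal maps.
\<close>

definition lebesgue_subspace :: "nat \<Rightarrow> (nat \<Rightarrow> real) set \<Rightarrow> (nat \<Rightarrow> real) measure"
  where "lebesgue_subspace n H =
    (let u = SOME u. orthonormal_basis_of n H u
     in distr (Pi\<^sub>M {..<dim H} (\<lambda>_. lborel)) (restrict_space borel H)
          (\<lambda>t. \<Sum>i<dim H. t i *\<^sub>R u i))"

text \<open>The value \<open>\<mu>(A \<inter> H)\<close> for the measure \<open>\<mu>\<close> on \<open>\<real>\<^sup>n\<close> with density \<open>\<phi>\<close>, for \<open>\<phi> \<ge> 0\<close>.\<close>

definition section_measure ::
    "nat \<Rightarrow> ((nat \<Rightarrow> real) \<Rightarrow> real) \<Rightarrow> (nat \<Rightarrow> real) set \<Rightarrow> (nat \<Rightarrow> real) set \<Rightarrow> ennreal"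
  where "section_measure n \<phi> H A =
    (\<integral>\<^sup>+ x. ennreal (\<phi> x) * indicator A x \<partial>lebesgue_subspace n H)"

end

theory Submission
  imports Defs
begin

text \<open>
  Let \<open>D = K - K\<close> and integrate \<open>\<phi>(x) vol\<^sub>n(K \<inter> (K - x))\<close> over \<open>x \<in> H\<close>. By Tonelli this is
  \<open>\<integral>\<^sub>K \<mu>((K - y) \<inter> H) dy\<close>, hence at most \<open>vol\<^sub>n(K)\<close> times the supremum. Conversely, if
  \<open>x = s(a - b)\<close> with \<open>a, b \<in> K\<close> and \<open>0 \<le> s \<le> 1\<close>, then \<open>K \<inter> (K - x)\<close> contains \<open>(1 - s)K + sb\<close>, so
  its volume is at least \<open>(1 - s)\<^sup>n vol\<^sub>n(K)\<close>. Writing \<open>(1 - s)\<^sup>n\<close> as the integral of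
  \<open>n(1 - r)\<^sup>n\<^sup>-\<^sup>1\<close> over \<open>r \<in> [s, 1]\<close>, the integral is at least
  \<open>vol\<^sub>n(K)\<close> times the integral of \<open>n(1 - r)\<^sup>n\<^sup>-\<^sup>1 \<mu>(rD \<inter> H)\<close> over \<open>r \<in> [0, 1]\<close>. Since \<open>\<phi>\<close> is radially
  decreasing, \<open>\<mu>(rD \<inter> H) \<ge> r\<^sup>m \<mu>(D \<inter> H)\<close>, and the remaining Beta integral \<open>n B(m + 1, n)\<close> is the
  inverse of the binomial coefficient. For the second inequality \<open>c = 2e\<close> works, by
  \<open>m! \<ge> (m/e)\<^sup>m\<close>.
\<close>

section \<open>Affine changes of variables for product Lebesgue measure\<close>

text \<open>The weighted image measure \<open>?N\<close> agrees with the product measure on boxes,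
  because the one-dimensional substitution applies in every factor, and boxes determine a product
  measure. This serves both to shrink \<open>K\<close> towards a point and to dilate inside the
  section.\<close>

lemma nn_integral_PiM_lborel_affine:
  fixes c :: real and a :: "'i \<Rightarrow> real"
  assumes I: "finite I" and c: "0 < c"
    and f: "f \<in> borel_measurable (Pi\<^sub>M I (\<lambda>_. lborel))"
  shows "(\<integral>\<^sup>+x. f x \<partial>Pi\<^sub>M I (\<lambda>_. lborel)) =
    ennreal (c ^ card I) * (\<integral>\<^sup>+x. f (\<lambda>i\<in>I. a i + c * x i) \<partial>Pi\<^sub>M I (\<lambda>_. lborel))"
proof -
  interpret product_sigma_finite "\<lambda>_::'i. lborel :: real measure" by standard
  let ?P = "Pi\<^sub>M I (\<lambda>_. lborel :: real measure)"
  let ?T = "\<lambda>x. \<lambda>i\<in>I. a i + c * x i"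
  have T[measurable]: "?T \<in> measurable ?P ?P" by measurable
  let ?N = "density (distr ?P ?P ?T) (\<lambda>_. ennreal (c ^ card I))"
  have "?N = ?P"
  proof (rule PiM_eqI[OF I])
    fix A assume A: "\<And>i. i \<in> I \<Longrightarrow> A i \<in> sets (lborel :: real measure)"
    have AP[measurable]: "Pi\<^sub>E I A \<in> sets ?P" using A I by (intro sets_PiM_I_finite) auto
    have pre: "?T -` Pi\<^sub>E I A \<inter> space ?P = Pi\<^sub>E I (\<lambda>i. (\<lambda>x. a i + c * x) -` A i \<inter> space borel)"
      by (auto simp: space_PiM PiE_iff)
    have m: "(\<lambda>x. a i + c * x) -` A i \<inter> space borel \<in> sets lborel" if "i \<in> I" for i
      using measurable_sets[of "\<lambda>x. a i + c * x" borel borel "A i"] A[OF that] by simp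
    have sc: "emeasure lborel (A i) = ennreal c * emeasure lborel ((\<lambda>x. a i + c * x) -` A i \<inter> space borel)"
      if "i \<in> I" for i
    proof -
      have "emeasure lborel (A i) = (\<integral>\<^sup>+x. indicator (A i) x \<partial>lborel)" using A[OF that] by simp
      also have "\<dots> = ennreal c * (\<integral>\<^sup>+x. indicator (A i) (a i + c * x) \<partial>lborel)"
        using nn_integral_real_affine[of "indicator (A i)" c "a i"] A[OF that] c by simp
      also have "(\<integral>\<^sup>+x. indicator (A i) (a i + c * x) \<partial>lborel) =
          (\<integral>\<^sup>+x. indicator ((\<lambda>x. a i + c * x) -` A i \<inter> space borel) x \<partial>lborel)"
        by (intro nn_integral_cong) (auto simp: indicator_def)
      also have "\<dots> = emeasure lborel ((\<lambda>x. a i + c * x) -` A i \<inter> space borel)"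
        using m[OF that] by simp
      finally show ?thesis .
    qed
    have "emeasure ?N (Pi\<^sub>E I A) = ennreal (c ^ card I) * emeasure (distr ?P ?P ?T) (Pi\<^sub>E I A)"
      by (simp add: emeasure_density_const)
    also have "\<dots> = ennreal (c ^ card I) *
        (\<Prod>i\<in>I. emeasure lborel ((\<lambda>x. a i + c * x) -` A i \<inter> space borel))"
      by (subst emeasure_distr[OF T AP], subst pre, subst emeasure_PiM[OF I m]) auto
    also have "\<dots> = (\<Prod>i\<in>I. ennreal c * emeasure lborel ((\<lambda>x. a i + c * x) -` A i \<inter> space borel))"
      using c by (simp add: prod.distrib ennreal_power)
    also have "\<dots> = (\<Prod>i\<in>I. emeasure lborel (A i))"
      using sc by (intro prod.cong) auto
    finally show "emeasure ?N (Pi\<^sub>E I A) = (\<Prod>i\<in>I. emeasure lborel (A i))" .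
  qed simp
  then have "(\<integral>\<^sup>+x. f x \<partial>?P) = (\<integral>\<^sup>+x. f x \<partial>?N)" by simp
  also have "\<dots> = ennreal (c ^ card I) * (\<integral>\<^sup>+x. f (?T x) \<partial>?P)"
    using f by (simp add: nn_integral_density nn_integral_cmult nn_integral_distr)
  finally show ?thesis .
qed

section \<open>Orthonormal bases of subspaces of \<open>Rn n\<close>\<close>

text \<open>An infinite set has cardinality 0, so positivity of \<open>dim H\<close> forces the
  basis to be finite. This matters because the ambient space of sequences is
  infinite-dimensional.\<close>

lemma finite_dimensional_basis:
  fixes H :: "'a::real_vector set"
  assumes "subspace H" "0 < dim H"
  obtains B where "finite B" "independent B" "span B = H" "card B = dim H"
proof -
  obtain B where B: "B \<subseteq> H" "independent B" "H \<subseteq> span B" "card B = dim H"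
    using basis_exists[of H] by blast
  then show thesis
    using that[of B] assms card_gt_0_iff[of B] span_minimal[of B H] by auto
qed

lemma sum_fun_apply: "(\<Sum>i\<in>A. f i) x = (\<Sum>i\<in>A. f i x)"
  for f :: "'i \<Rightarrow> 'a \<Rightarrow> 'b::comm_monoid_add"
  by (induction A rule: infinite_finite_induct) auto

lemma orthonormal_family_independent:
  fixes u :: "nat \<Rightarrow> nat \<Rightarrow> real"
  assumes on: "\<forall>i<k. \<forall>j<k. (\<Sum>l<n. u i l * u j l) = (if i = j then 1 else 0)"
  shows "inj_on u {..<k}" "independent (u ` {..<k})"
proof -
  show inj: "inj_on u {..<k}"
  proof (rule inj_onI)
    fix i j assume "i \<in> {..<k}" "j \<in> {..<k}" "u i = u j"
    then show "i = j" using on[rule_format, of i i] on[rule_format, of i j] by (auto split: if_splits)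
  qed
  show "independent (u ` {..<k})"
  proof (rule independent_if_scalars_zero)
    fix f x assume s: "(\<Sum>x\<in>u ` {..<k}. f x *\<^sub>R x) = 0" and x: "x \<in> u ` {..<k}"
    from x obtain j where j: "j < k" "x = u j" by auto
    have s': "(\<Sum>i<k. f (u i) *\<^sub>R u i) = 0" using s by (simp add: sum.reindex[OF inj])
    have "0 = (\<Sum>l<n. (\<Sum>i<k. f (u i) *\<^sub>R u i) l * u j l)" by (simp add: s')
    also have "\<dots> = (\<Sum>l<n. \<Sum>i<k. f (u i) * (u i l * u j l))"
      by (simp add: sum_distrib_right mult.assoc sum_fun_apply)
    also have "\<dots> = (\<Sum>i<k. f (u i) * (\<Sum>l<n. u i l * u j l))"
      by (subst sum.swap) (simp add: sum_distrib_left)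
    also have "\<dots> = (\<Sum>i<k. if i = j then f (u i) else 0)"
      using on j by (intro sum.cong) auto
    also have "\<dots> = f x" using j by simp
    finally show "f x = 0" by simp
  qed simp
qed

text \<open>Gram-Schmidt, adding one vector at a time. Existence is what gives meaning to the
  \<open>SOME\<close> choice of basis in \<open>lebesgue_subspace\<close>.\<close>

lemma orthonormal_basis_exists:
  assumes H: "H \<subseteq> Rn n" "subspace H" "0 < dim H"
  shows "\<exists>u. orthonormal_basis_of n H u"
proof -
  obtain B where B: "finite B" "independent B" "span B = H" "card B = dim H"
    using finite_dimensional_basis[OF H(2,3)] by blast
  have ex: "\<exists>u. (\<forall>i<k. u i \<in> H) \<and>
      (\<forall>i<k. \<forall>j<k. (\<Sum>l<n. u i l * u j l) = (if i = j then 1 else (0::real)))"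
    if "k \<le> dim H" for k
    using that
  proof (induction k)
    case 0
    show ?case by simp
  next
    case (Suc k)
    then obtain u where u: "\<forall>i<k. u i \<in> H"
      and on: "\<forall>i<k. \<forall>j<k. (\<Sum>l<n. u i l * u j l) = (if i = j then 1 else (0::real))"
      by auto
    have "span (u ` {..<k}) \<subseteq> H" using u H(2) by (intro span_minimal) auto
    \<comment> \<open>The span of \<open>k < dim H\<close> vectors cannot contain the independent
      set \<open>B\<close> of size \<open>dim H\<close>.\<close>
    moreover have "\<not> H \<subseteq> span (u ` {..<k})"
    proof
      assume "H \<subseteq> span (u ` {..<k})"
      then have "B \<subseteq> span (u ` {..<k})" using B(3) span_superset[of B] by blast
      then have "card B \<le> card (u ` {..<k})"
        using independent_span_bound[OF _ B(2)] by blast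
      also have "\<dots> \<le> k" using card_image_le[of "{..<k}" u] by simp
      finally show False using B(4) Suc.prems by simp
    qed
    ultimately obtain v where v: "v \<in> H" "v \<notin> span (u ` {..<k})" by blast
    define p where "p = (\<Sum>i<k. (\<Sum>l<n. v l * u i l) *\<^sub>R u i)"
    define w where "w = v - p"
    have p: "p \<in> span (u ` {..<k})" unfolding p_def by (intro span_sum span_scale span_base) auto
    have w0: "w \<noteq> 0" using p v(2) by (auto simp: w_def)
    have wH: "w \<in> H" unfolding w_def p_def
      using u v(1) H(2) by (intro subspace_diff subspace_sum subspace_scale) auto
    have orth: "(\<Sum>l<n. w l * u j l) = 0" if "j < k" for j
    proof -
      have "(\<Sum>l<n. p l * u j l) = (\<Sum>l<n. \<Sum>i<k. (\<Sum>l<n. v l * u i l) * (u i l * u j l))"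
        by (simp add: p_def sum_fun_apply sum_distrib_right mult.assoc)
      also have "\<dots> = (\<Sum>i<k. (\<Sum>l<n. v l * u i l) * (\<Sum>l<n. u i l * u j l))"
        by (subst sum.swap) (simp add: sum_distrib_left)
      also have "\<dots> = (\<Sum>i<k. if i = j then (\<Sum>l<n. v l * u i l) else 0)"
        using on that by (intro sum.cong) auto
      also have "\<dots> = (\<Sum>l<n. v l * u j l)" using that by simp
      finally show ?thesis by (simp add: w_def left_diff_distrib sum_subtractf)
    qed
    define N where "N = (\<Sum>l<n. w l * w l)"
    \<comment> \<open>Elements of \<open>H\<close> vanish from index \<open>n\<close> on, so a
      nonzero \<open>w\<close> has a nonzero entry below \<open>n\<close>; hence the truncated
      square sum \<open>N\<close> is positive.\<close>
    have "\<exists>l<n. w l \<noteq> 0"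
    proof (rule ccontr)
      assume "\<not> ?thesis"
      then have "w l = 0" for l
        using wH H(1) by (cases "l < n") (auto simp: topspace_Euclidean_space)
      then show False using w0 by (auto simp: fun_eq_iff)
    qed
    then obtain l where "l < n" "w l \<noteq> 0" by blast
    then have N: "0 < N" unfolding N_def
      by (intro sum_pos2[of _ l]) (auto simp: zero_less_mult_iff)
    define w' where "w' = (1 / sqrt N) *\<^sub>R w"
    have w'w': "(\<Sum>l<n. w' l * w' l) = 1"
    proof -
      have "(\<Sum>l<n. w' l * w' l) = (\<Sum>l<n. w l * w l / N)"
        using N by (intro sum.cong) (auto simp: w'_def)
      also have "\<dots> = N / N" unfolding N_def by (rule sum_divide_distrib[symmetric])
      finally show ?thesis using N by simp
    qed
    have w'u: "(\<Sum>l<n. w' l * u j l) = 0" if "j < k" for j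
      using orth[OF that] by (simp add: w'_def flip: sum_divide_distrib)
    then have uw': "(\<Sum>l<n. u j l * w' l) = 0" if "j < k" for j
      using that by (simp add: mult.commute)
    have "w' \<in> H" unfolding w'_def using wH H(2) by (intro subspace_scale)
    then show ?case
      using u on w'w' w'u uw' by (intro exI[of _ "u(k := w')"]) (auto simp: less_Suc_eq)
  qed
  obtain u where u: "\<forall>i<dim H. u i \<in> H"
    and on: "\<forall>i<dim H. \<forall>j<dim H. (\<Sum>l<n. u i l * u j l) = (if i = j then 1 else (0::real))"
    using ex[OF order_refl] by blast
  note ind = orthonormal_family_independent[OF on]
  have sub: "span (u ` {..<dim H}) \<subseteq> H" using u H(2) by (intro span_minimal) auto
  \<comment> \<open>A vector of \<open>H\<close> outside this span would give
    \<open>dim H + 1\<close> independent vectors in the span of \<open>B\<close>.\<close>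
  have "H \<subseteq> span (u ` {..<dim H})"
  proof (rule ccontr)
    assume "\<not> ?thesis"
    then obtain v where v: "v \<in> H" "v \<notin> span (u ` {..<dim H})" by blast
    have "independent (insert v (u ` {..<dim H}))"
      using ind(2) v(2) by (simp add: independent_insert)
    moreover have "insert v (u ` {..<dim H}) \<subseteq> span B" using v(1) u B(3) by auto
    ultimately have "card (insert v (u ` {..<dim H})) \<le> card B"
      using independent_span_bound[OF B(1)] by blast
    moreover have "card (u ` {..<dim H}) = dim H" using ind(1) by (simp add: card_image)
    moreover have "v \<notin> u ` {..<dim H}" using v(2) span_superset[of "u ` {..<dim H}"] by blast
    ultimately show False using B(4) by simp
  qed
  with sub u on H(1) show ?thesis unfolding orthonormal_basis_of_def by (intro exI[of _ u]) auto
qed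

section \<open>Volume of a convex body\<close>

lemma compactin_Euclidean_space:
  assumes "compactin (Euclidean_space n) K"
  shows "compact K" "K \<subseteq> Rn n"
proof -
  show "compact K" using assms
    by (simp add: Euclidean_space_def compactin_subtopology euclidean_product_topology)
  show "K \<subseteq> Rn n" using assms by (rule compactin_subset_topspace)
qed

text \<open>
  Points of the product space \<open>Pi\<^sub>M {..<n}\<close> are \<open>undefined\<close> beyond \<open>n\<close>, those of \<open>Rn n\<close> are \<open>0\<close>
  there.
\<close>

definition vec_ext :: "nat \<Rightarrow> (nat \<Rightarrow> real) \<Rightarrow> nat \<Rightarrow> real"
  where "vec_ext n y = (\<lambda>i. if i < n then y i else 0)"

abbreviation lebesgue_n :: "nat \<Rightarrow> (nat \<Rightarrow> real) measure"
  where "lebesgue_n n \<equiv> Pi\<^sub>M {..<n} (\<lambda>_. lborel)"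

definition volume_n :: "nat \<Rightarrow> (nat \<Rightarrow> real) set \<Rightarrow> ennreal"
  where "volume_n n K = (\<integral>\<^sup>+y. indicator K (vec_ext n y) \<partial>lebesgue_n n)"

lemma vec_ext_in_Rn: "vec_ext n y \<in> Rn n"
  by (simp add: vec_ext_def topspace_Euclidean_space)

lemma measurable_vec_ext [measurable]: "vec_ext n \<in> borel_measurable (lebesgue_n n)"
proof (rule measurable_coordinatewise_then_product)
  show "(\<lambda>y. vec_ext n y i) \<in> borel_measurable (lebesgue_n n)" for i
    by (cases "i < n") (simp_all add: vec_ext_def)
qed

text \<open>Each coordinate is bounded on a compact set, which confines the first \<open>n\<close>
  coordinates to a box. Together with positivity, finiteness later allows the volume to be
  cancelled.\<close>

lemma volume_n_compact_finite:
  assumes "compact K"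
  shows "volume_n n K < \<infinity>"
proof -
  interpret product_sigma_finite "\<lambda>_::nat. lborel :: real measure" by standard
  have "\<exists>b. \<forall>x\<in>K. \<bar>x i\<bar> \<le> b" for i
  proof -
    have "compact ((\<lambda>x. x i) ` K)"
      by (intro compact_continuous_image[OF _ assms]
          continuous_on_product_then_coordinatewise[OF continuous_on_id])
    then have "bounded ((\<lambda>x. x i) ` K)" by (rule compact_imp_bounded)
    then show ?thesis by (auto simp: bounded_iff)
  qed
  then obtain b where b: "\<And>i x. x \<in> K \<Longrightarrow> \<bar>x i\<bar> \<le> b i" by metis
  have bs: "Pi\<^sub>E {..<n} (\<lambda>i. {- b i..b i}) \<in> sets (lebesgue_n n)"
    by (intro sets_PiM_I_finite) auto
  have "volume_n n K \<le> (\<integral>\<^sup>+y. indicator (Pi\<^sub>E {..<n} (\<lambda>i. {- b i..b i})) y \<partial>lebesgue_n n)"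
    unfolding volume_n_def
  proof (rule nn_integral_mono)
    fix y assume y: "y \<in> space (lebesgue_n n)"
    have "y \<in> Pi\<^sub>E {..<n} (\<lambda>i. {- b i..b i})" if "vec_ext n y \<in> K"
    proof (rule PiE_I)
      fix i assume "i \<in> {..<n}"
      then have "\<bar>y i\<bar> \<le> b i" using b[OF that, of i] by (simp add: vec_ext_def)
      then show "y i \<in> {- b i..b i}" unfolding abs_le_iff by auto
    next
      fix i assume "i \<notin> {..<n}"
      then show "y i = undefined" using y unfolding space_PiM by (rule PiE_arb[rotated])
    qed
    then show "indicator K (vec_ext n y) \<le>
        (indicator (Pi\<^sub>E {..<n} (\<lambda>i. {- b i..b i})) y :: ennreal)"
      by (auto simp: indicator_def)
  qed
  also have "\<dots> = emeasure (lebesgue_n n) (Pi\<^sub>E {..<n} (\<lambda>i. {- b i..b i}))" using bs by simp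
  also have "\<dots> = (\<Prod>i<n. emeasure lborel {- b i..b i})" by (subst emeasure_PiM) auto
  also have "\<dots> < \<infinity>" by (simp add: emeasure_lborel_Icc_eq) (subst prod_ennreal; simp)
  finally show ?thesis .
qed

text \<open>The topology is that of pointwise convergence, so an interior point has a product
  neighbourhood \<open>X\<close> whose trace on \<open>Rn n\<close> lies in \<open>K\<close>; the
  first \<open>n\<close> factors of \<open>X\<close> form a box of positive volume.\<close>

lemma volume_n_pos:
  assumes "Euclidean_space n interior_of K \<noteq> {}"
  shows "0 < volume_n n K"
proof -
  interpret product_sigma_finite "\<lambda>_::nat. lborel :: real measure" by standard
  obtain U x where U: "openin (Euclidean_space n) U" "x \<in> U" "U \<subseteq> K"
    using assms by (auto simp: interior_of_def)
  obtain T where T: "openin (powertop_real UNIV) T" "U = T \<inter> {y. \<forall>i\<ge>n. y i = 0}"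
    using U(1) by (auto simp: Euclidean_space_def openin_subtopology)
  obtain X where X: "x \<in> Pi\<^sub>E UNIV X" "\<forall>i. open (X i)" "Pi\<^sub>E UNIV X \<subseteq> T"
    using product_topology_open_contains_basis[OF T(1), of x] U(2) T(2) by auto
  have xs: "x i \<in> X i" for i using X(1) by (auto simp: PiE_iff)
  have bs: "Pi\<^sub>E {..<n} X \<in> sets (lebesgue_n n)"
    using X(2) by (intro sets_PiM_I_finite) auto
  have pos: "emeasure lborel (X i) \<noteq> 0" for i
  proof -
    obtain e where e: "0 < e" "ball (x i) e \<subseteq> X i"
      using X(2) xs[of i] open_contains_ball[of "X i"] by auto
    have "0 < emeasure lborel {x i - e <..< x i + e}" using e(1) by simp
    also have "\<dots> \<le> emeasure lborel (X i)"
      using e(2) X(2) by (intro emeasure_mono) (auto simp: ball_eq_greaterThanLessThan)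
    finally show ?thesis by simp
  qed
  have "0 < (\<Prod>i<n. emeasure lborel (X i))" using pos by (simp add: zero_less_iff_neq_zero)
  also have "\<dots> = emeasure (lebesgue_n n) (Pi\<^sub>E {..<n} X)" using X(2) by (subst emeasure_PiM) auto
  also have "\<dots> = (\<integral>\<^sup>+y. indicator (Pi\<^sub>E {..<n} X) y \<partial>lebesgue_n n)" using bs by simp
  also have "\<dots> \<le> volume_n n K" unfolding volume_n_def
  proof (rule nn_integral_mono)
    fix y
    have "vec_ext n y \<in> K" if y: "y \<in> Pi\<^sub>E {..<n} X"
    proof -
      \<comment> \<open>Beyond \<open>n\<close> both \<open>x\<close> and \<open>vec_ext n y\<close>
        are 0, so membership of \<open>x i\<close> in \<open>X i\<close> carries over to those
        coordinates.\<close>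
      have x0: "x i = 0" if "i \<ge> n" for i using U(2) T(2) that by auto
      have "vec_ext n y i \<in> X i" for i
        using y xs[of i] x0[of i] by (cases "i < n") (auto simp: vec_ext_def PiE_iff)
      then have "vec_ext n y \<in> T" using X(3) by (auto simp: PiE_iff)
      then show ?thesis using U(3) T(2) by (auto simp: vec_ext_def)
    qed
    then show "indicator (Pi\<^sub>E {..<n} X) y \<le> (indicator K (vec_ext n y) :: ennreal)"
      by (auto simp: indicator_def)
  qed
  finally show ?thesis .
qed

section \<open>Overlap of a convex body with its translates\<close>

text \<open>The right-hand side is the covariogram of \<open>K\<close>. By convexity the contraction
  \<open>y -> (1 - s) y + s b\<close> maps \<open>K\<close> into the overlap, and it scales volume
  by \<open>(1 - s) ^ n\<close>.\<close>

lemma covariogram_lower_bound: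
  assumes n: "1 \<le> n" and K: "K \<subseteq> Rn n" "convex K" "K \<in> sets borel"
    and s: "0 \<le> s" "s \<le> 1" and ab: "a \<in> K" "b \<in> K"
  shows "volume_n n K * ennreal ((1 - s) ^ n) \<le>
    (\<integral>\<^sup>+y. indicator K (vec_ext n y) * indicator K (vec_ext n y + s *\<^sub>R (a - b)) \<partial>lebesgue_n n)"
proof (cases "s = 1")
  \<comment> \<open>Here the contraction degenerates, but the left side vanishes because
    \<open>n\<close> is positive.\<close>
  case True
  then show ?thesis using n by (simp add: zero_power)
next
  case False
  then have s1: "s < 1" using s by simp
  let ?f = "\<lambda>y. indicator K (vec_ext n y) * indicator K (vec_ext n y + s *\<^sub>R (a - b)) :: ennreal"
  let ?A = "\<lambda>y. \<lambda>i\<in>{..<n}. s * b i + (1 - s) * y i"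
  have b: "vec_ext n (?A y) = (1 - s) *\<^sub>R vec_ext n y + s *\<^sub>R b" for y
    using ab(2) K(1) by (auto simp: fun_eq_iff vec_ext_def topspace_Euclidean_space subset_iff)
  have [measurable]: "(\<lambda>y. vec_ext n y + s *\<^sub>R (a - b)) \<in> borel_measurable (lebesgue_n n)"
  proof (rule measurable_coordinatewise_then_product)
    show "(\<lambda>y. (vec_ext n y + s *\<^sub>R (a - b)) i) \<in> borel_measurable (lebesgue_n n)" for i
      by (cases "i < n") (simp_all add: vec_ext_def)
  qed
  note [measurable] = K(3)
  have le: "indicator K (vec_ext n y) \<le> ?f (?A y)" for y
  proof -
    have "?f (?A y) = 1" if y: "vec_ext n y \<in> K"
    proof -
      \<comment> \<open>Shifting the contracted point by \<open>s (a - b)\<close> exchanges the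
        centre \<open>b\<close> for \<open>a\<close>, so both points are convex combinations of
        elements of \<open>K\<close>.\<close>
      have eq: "(1 - s) *\<^sub>R vec_ext n y + s *\<^sub>R b + s *\<^sub>R (a - b) = (1 - s) *\<^sub>R vec_ext n y + s *\<^sub>R a"
        by (simp add: algebra_simps)
      have "(1 - s) *\<^sub>R vec_ext n y + s *\<^sub>R a \<in> K" "(1 - s) *\<^sub>R vec_ext n y + s *\<^sub>R b \<in> K"
        using K(2) y ab s by (auto intro!: convexD)
      then show ?thesis unfolding b eq by simp
    qed
    then show ?thesis by (auto simp: indicator_def)
  qed
  have "volume_n n K * ennreal ((1 - s) ^ n) \<le> ennreal ((1 - s) ^ n) * (\<integral>\<^sup>+y. ?f (?A y) \<partial>lebesgue_n n)"
    unfolding volume_n_def using le by (subst mult.commute) (intro mult_left_mono nn_integral_mono, auto)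
  also have "\<dots> = (\<integral>\<^sup>+y. ?f y \<partial>lebesgue_n n)"
    using nn_integral_PiM_lborel_affine[of "{..<n}" "1 - s" ?f "\<lambda>i. s * b i"] s1 by simp
  finally show ?thesis .
qed

section \<open>Weighted one-dimensional integrals and the binomial estimate\<close>

text \<open>In the application \<open>E\<close> consists of the scales \<open>s\<close> at which a
  fixed point lies in \<open>sD\<close>. Closedness puts \<open>Inf E\<close> into \<open>E\<close>,
  so the hypothesis is available at the least scale, where it is strongest; the weight over
  \<open>{Inf E..1}\<close>, which covers \<open>E\<close>, integrates to exactly
  \<open>(1 - Inf E) ^ n\<close>.\<close>

lemma layer_cake_bound:
  fixes E :: "real set" and V r :: ennreal
  assumes n: "1 \<le> n" and E: "closed E" "E \<subseteq> {0..1}"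
    and le: "\<And>s. s \<in> E \<Longrightarrow> V * ennreal ((1 - s) ^ n) \<le> r"
  shows "V * (\<integral>\<^sup>+s. ennreal (real n * (1 - s) ^ (n - 1)) * indicator E s \<partial>lborel) \<le> r"
proof (cases "E = {}")
  case False
  have bdd: "bdd_below E" using E(2) by (meson atLeastAtMost_iff bdd_belowI subsetD)
  have I: "Inf E \<in> E" using closed_contains_Inf[OF False bdd E(1)] .
  then have I01: "0 \<le> Inf E" "Inf E \<le> 1" using E(2) by auto
  have "(\<integral>\<^sup>+s. ennreal (real n * (1 - s) ^ (n - 1)) * indicator E s \<partial>lborel) \<le>
      (\<integral>\<^sup>+s. ennreal (real n * (1 - s) ^ (n - 1)) * indicator {Inf E..1} s \<partial>lborel)"
    using E(2) bdd by (intro nn_integral_mono mult_left_mono) (auto simp: indicator_def cInf_lower)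
  also have "\<dots> = ennreal (- ((1 - 1) ^ n) - - ((1 - Inf E) ^ n))"
    using I01 by (intro nn_integral_FTC_Icc) (auto intro!: derivative_eq_intros)
  also have "\<dots> = ennreal ((1 - Inf E) ^ n)" using n by (simp add: zero_power)
  finally have "V * (\<integral>\<^sup>+s. ennreal (real n * (1 - s) ^ (n - 1)) * indicator E s \<partial>lborel) \<le>
      V * ennreal ((1 - Inf E) ^ n)" by (intro mult_left_mono) auto
  also have "\<dots> \<le> r" using le[OF I] .
  finally show ?thesis .
qed simp

text \<open>The value is \<open>n B(m + 1, n) = n! m! / (n + m)!\<close>.\<close>

lemma nn_integral_beta_binomial:
  assumes n: "1 \<le> n"
  shows "(\<integral>\<^sup>+s. ennreal (real n * (1 - s) ^ (n - 1)) * ennreal (s ^ m) * indicator {0..1} s \<partial>lborel)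
    = ennreal (1 / real ((n + m) choose m))"
proof -
  have B: "Beta (real m + 1) (real n) = fact m * fact (n - 1) / fact (n + m)"
    using Gamma_fact[of m, where 'a = real] Gamma_fact[of "n - 1", where 'a = real]
      Gamma_fact[of "n + m", where 'a = real] n
    by (simp add: Beta_def of_nat_diff algebra_simps)
  \<comment> \<open>The open interval avoids the endpoints, where \<open>0 powr 0 = 0\<close> may
    clash with \<open>0 ^ 0 = 1\<close>.\<close>
  have "((\<lambda>t. t powr (real m + 1 - 1) * (1 - t) powr (real n - 1)) has_integral Beta (real m + 1) (real n)) {0<..<1}"
    using has_integral_Beta_real[of "real m + 1" "real n"] n by (simp add: has_integral_Icc_iff_Ioo)
  also have "?this \<longleftrightarrow> ((\<lambda>t. t ^ m * (1 - t) ^ (n - 1)) has_integral Beta (real m + 1) (real n)) {0<..<1}"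
  proof (rule has_integral_cong)
    fix t :: real assume t: "t \<in> {0<..<1}"
    obtain k where "n = Suc k" using n by (cases n) auto
    then show "t powr (real m + 1 - 1) * (1 - t) powr (real n - 1) = t ^ m * (1 - t) ^ (n - 1)"
      using t by (simp add: powr_realpow)
  qed
  finally have "((\<lambda>t. real n * (t ^ m * (1 - t) ^ (n - 1))) has_integral
      real n * Beta (real m + 1) (real n)) {0..1}"
    by (intro has_integral_mult_right) (simp add: has_integral_Icc_iff_Ioo)
  moreover have "real n * Beta (real m + 1) (real n) = 1 / real ((n + m) choose m)"
  proof -
    have "fact n = real n * fact (n - 1)" using n by (simp add: fact_reduce)
    then show ?thesis unfolding B by (simp add: binomial_fact field_simps)
  qed
  ultimately have hi: "((\<lambda>t. indicator {0..1} t * (real n * (t ^ m * (1 - t) ^ (n - 1)))) has_integral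
      1 / real ((n + m) choose m)) UNIV"
    by (subst (asm) has_integral_restrict_UNIV[symmetric])
      (auto elim!: has_integral_eq[rotated] simp: indicator_def)
  have "(\<integral>\<^sup>+s. ennreal (real n * (1 - s) ^ (n - 1)) * ennreal (s ^ m) * indicator {0..1} s \<partial>lborel) =
     (\<integral>\<^sup>+t. ennreal (indicator {0..1} t * (real n * (t ^ m * (1 - t) ^ (n - 1)))) \<partial>lborel)"
    by (intro nn_integral_cong) (auto simp: indicator_def ac_simps simp flip: ennreal_mult)
  also have "\<dots> = ennreal (1 / real ((n + m) choose m))"
    using hi by (intro nn_integral_has_integral_lborel) (auto simp: indicator_def)
  finally show ?thesis .
qed

text \<open>The binomial coefficient times \<open>m!\<close> is at most \<open>(n + m)^m\<close>,
  hence at most \<open>(2n)^m\<close>, while \<open>m^m\<close> is at most \<open>e^m m!\<close>.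
  These two estimates produce the factors 2 and \<open>e\<close> of the constant.\<close>

lemma binomial_le_linear_power:
  assumes "1 \<le> m" "m \<le> n"
  shows "real ((n + m) choose m) \<le> (2 * exp 1 * real n / real m) ^ m"
proof -
  \<comment> \<open>A single term of the exponential series at \<open>m\<close> is at most the whole
    sum, all terms being nonnegative.\<close>
  have "(\<Sum>k\<in>{m}. real m ^ k /\<^sub>R fact k) \<le> (\<Sum>k. real m ^ k /\<^sub>R fact k)"
    by (intro sum_le_suminf summable_exp_generic) auto
  then have "real m ^ m / fact m \<le> exp (real m)"
    by (simp add: exp_def divide_inverse mult.commute)
  then have m: "real m ^ m \<le> exp 1 ^ m * fact m"
    by (simp add: field_simps exp_of_nat_mult[symmetric])
  have "((n + m) choose m) * fact m \<le> (n + m) ^ m" by (rule binomial_fact_pow)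
  also have "\<dots> \<le> (2 * n) ^ m" using assms by (intro power_mono) auto
  finally have "real (((n + m) choose m) * fact m) \<le> real ((2 * n) ^ m)"
    by (rule of_nat_mono)
  then have b: "real ((n + m) choose m) * fact m \<le> (2 * real n) ^ m" by simp
  have "(real ((n + m) choose m) * real m ^ m) * fact m \<le> (2 * real n) ^ m * real m ^ m"
    using mult_right_mono[OF b, of "real m ^ m"] by (simp add: mult_ac)
  also have "\<dots> \<le> (2 * real n) ^ m * (exp 1 ^ m * fact m)"
    by (intro mult_left_mono m) auto
  finally have "real ((n + m) choose m) * real m ^ m \<le> (2 * real n) ^ m * exp 1 ^ m"
    by (simp add: mult.assoc[symmetric])
  then show ?thesis using assms by (simp add: power_divide power_mult_distrib field_simps)
qed

section \<open>Coordinates on sections, and dilates of the difference body\<close>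

text \<open>For an orthonormal basis \<open>u\<close> of \<open>H\<close> this is the linear
  isometry onto \<open>H\<close> that turns integration over \<open>H\<close> into integration
  against a product measure.\<close>

definition param :: "nat \<Rightarrow> (nat \<Rightarrow> nat \<Rightarrow> real) \<Rightarrow> (nat \<Rightarrow> real) \<Rightarrow> nat \<Rightarrow> real"
  where "param m u t = (\<Sum>i<m. t i *\<^sub>R u i)"

definition param_measure ::
    "nat \<Rightarrow> ((nat \<Rightarrow> real) \<Rightarrow> real) \<Rightarrow> (nat \<Rightarrow> nat \<Rightarrow> real) \<Rightarrow> (nat \<Rightarrow> real) set \<Rightarrow> ennreal"
  where "param_measure m \<phi> u A =
    (\<integral>\<^sup>+t. ennreal (\<phi> (param m u t)) * indicator A (param m u t) \<partial>lebesgue_n m)"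

lemma param_apply: "param m u t k = (\<Sum>i<m. t i * u i k)"
  by (simp add: param_def sum_fun_apply)

lemma measurable_param [measurable]: "param m u \<in> borel_measurable (lebesgue_n m)"
  by (rule measurable_coordinatewise_then_product) (simp add: param_apply)

definition diff_body :: "(nat \<Rightarrow> real) set \<Rightarrow> (nat \<Rightarrow> real) set"
  where "diff_body K = {a - b | a b. a \<in> K \<and> b \<in> K}"

lemma compact_diff_body:
  assumes "compact K"
  shows "compact (diff_body K)"
proof -
  have eq: "diff_body K = (\<lambda>(a, b). a - b) ` (K \<times> K)" by (auto simp: diff_body_def)
  show ?thesis unfolding eq
  proof (rule compact_continuous_image[OF continuous_on_coordinatewise_then_product
        compact_Times[OF assms assms]])
    have "continuous_on (K \<times> K) (\<lambda>p. fst p i - snd p i)" for i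
      by (intro continuous_on_diff
          continuous_on_product_then_coordinatewise[OF continuous_on_fst[OF continuous_on_id]]
          continuous_on_product_then_coordinatewise[OF continuous_on_snd[OF continuous_on_id]])
    then show "continuous_on (K \<times> K) (\<lambda>p. (case p of (a, b) \<Rightarrow> a - b) i)" for i
      by (simp add: case_prod_beta)
  qed
qed

text \<open>All dilates of \<open>D\<close> are collected in one set of pairs: its closedness yields
  both the joint measurability needed for Tonelli and closed sets of scales at each fixed
  point.\<close>

definition dilation_graph :: "(nat \<Rightarrow> real) set \<Rightarrow> (real \<times> (nat \<Rightarrow> real)) set"
  where "dilation_graph K = (\<lambda>(s, z). (s, s *\<^sub>R z)) ` ({0..1} \<times> diff_body K)"

lemma closed_dilation_graph:
  assumes "compact K"
  shows "closed (dilation_graph K)"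
proof -
  have "continuous_on ({0..1} \<times> diff_body K) (\<lambda>p. (fst p, fst p *\<^sub>R snd p))"
  proof (rule continuous_on_Pair[OF continuous_on_fst[OF continuous_on_id]
        continuous_on_coordinatewise_then_product])
    have "continuous_on ({0..1} \<times> diff_body K) (\<lambda>p. fst p * snd p i)" for i
      by (intro continuous_on_mult continuous_on_fst[OF continuous_on_id]
          continuous_on_product_then_coordinatewise[OF continuous_on_snd[OF continuous_on_id]])
    then show "continuous_on ({0..1} \<times> diff_body K) (\<lambda>p. (fst p *\<^sub>R snd p) i)" for i
      by simp
  qed
  then have "compact ((\<lambda>p. (fst p, fst p *\<^sub>R snd p)) ` ({0..1} \<times> diff_body K))"
    by (intro compact_continuous_image compact_Times compact_diff_body assms) auto
  then show ?thesis unfolding dilation_graph_def by (intro compact_imp_closed) (simp add: case_prod_beta)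
qed

section \<open>The double integral over the section and the body\<close>

context
  fixes n m :: nat and \<phi> :: "(nat \<Rightarrow> real) \<Rightarrow> real" and u :: "nat \<Rightarrow> nat \<Rightarrow> real"
    and K :: "(nat \<Rightarrow> real) set"
  assumes mn: "1 \<le> m" "1 \<le> n"
    and meas: "\<phi> \<in> borel_measurable (restrict_space borel (Rn n))"
    and rad: "radially_decreasing n \<phi>"
    and u: "\<And>i. i < m \<Longrightarrow> u i \<in> Rn n"
    and K: "convex_body n K"
begin

lemma param_in_Rn: "param m u t \<in> Rn n"
  using u by (simp add: param_apply topspace_Euclidean_space)

lemma measurable_density_param [measurable]:
  "(\<lambda>t. \<phi> (param m u t)) \<in> borel_measurable (lebesgue_n m)"
  by (rule measurable_compose[OF _ meas])
    (auto intro!: measurable_restrict_space2 param_in_Rn)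

lemma compact_K: "compact K" and K_Rn: "K \<subseteq> Rn n" and convex_K: "convex K"
  using K compactin_Euclidean_space by (auto simp: convex_body_def)

lemma borel_K [measurable]: "K \<in> sets borel"
  by (intro borel_closed compact_imp_closed compact_K)

lemma borel_dilation_graph [measurable]: "dilation_graph K \<in> sets borel"
  by (intro borel_closed closed_dilation_graph compact_K)

lemma measurable_dilation_graph [measurable]:
  "(\<lambda>(t, s). indicator (dilation_graph K) (s, param m u t) :: ennreal) \<in> borel_measurable (lebesgue_n m \<Otimes>\<^sub>M lborel)"
proof -
  have "(\<lambda>p. (snd p, param m u (fst p))) \<in> measurable (lebesgue_n m \<Otimes>\<^sub>M lborel) (borel \<Otimes>\<^sub>M borel)"
    by measurable
  \<comment> \<open>The product of the Borel algebras is the Borel algebra of the product because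
    both spaces are second countable.\<close>
  then have [measurable]: "(\<lambda>p. (snd p, param m u (fst p))) \<in> borel_measurable (lebesgue_n m \<Otimes>\<^sub>M lborel)"
    by (simp add: borel_prod)
  have "(\<lambda>p. indicator (dilation_graph K) (snd p, param m u (fst p)) :: ennreal) \<in> borel_measurable (lebesgue_n m \<Otimes>\<^sub>M lborel)"
    by measurable
  then show ?thesis by (simp add: case_prod_beta)
qed

text \<open>The substitution \<open>t -> s t\<close> contributes \<open>s ^ m\<close>, moves points
  of \<open>D\<close> into \<open>sD\<close>, and can only raise the density because
  \<open>\<phi>\<close> is radially decreasing.\<close>

lemma param_measure_dilate:
  assumes s: "0 \<le> s" "s \<le> 1"
  shows "ennreal (s ^ m) * param_measure m \<phi> u (diff_body K) \<le>
    (\<integral>\<^sup>+t. ennreal (\<phi> (param m u t)) * indicator (dilation_graph K) (s, param m u t) \<partial>lebesgue_n m)"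
proof (cases "s = 0")
  \<comment> \<open>The substitution needs a positive factor; at \<open>s = 0\<close> the left side
    is 0 because \<open>m\<close> is positive.\<close>
  case True
  then show ?thesis using mn by (simp add: zero_power)
next
  case False
  let ?f = "\<lambda>t. ennreal (\<phi> (param m u t)) * indicator (dilation_graph K) (s, param m u t)"
  have f: "?f \<in> borel_measurable (lebesgue_n m)"
    using measurable_compose[OF measurable_Pair[OF measurable_ident_sets[OF refl] measurable_const[of s lborel]] measurable_dilation_graph]
    by simp
  have par: "param m u (\<lambda>i\<in>{..<m}. 0 + s * t i) = s *\<^sub>R param m u t" for t
    by (simp add: fun_eq_iff param_apply sum_distrib_left mult.assoc)
  have "param_measure m \<phi> u (diff_body K) \<le> (\<integral>\<^sup>+t. ?f (\<lambda>i\<in>{..<m}. 0 + s * t i) \<partial>lebesgue_n m)"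
    unfolding param_measure_def par
  proof (intro nn_integral_mono mult_mono ennreal_leI)
    fix t
    show "\<phi> (param m u t) \<le> \<phi> (s *\<^sub>R param m u t)"
      using rad s param_in_Rn[of t] by (auto simp: radially_decreasing_def)
    show "indicator (diff_body K) (param m u t) \<le> (indicator (dilation_graph K) (s, s *\<^sub>R param m u t) :: ennreal)"
      using s by (auto simp: indicator_def dilation_graph_def image_iff)
  qed auto
  then show ?thesis
    using nn_integral_PiM_lborel_affine[of "{..<m}" s ?f "\<lambda>_. 0"] False s f
    by (simp add: mult_left_mono)
qed

text \<open>At a fixed section point, every scale \<open>s\<close> whose dilate contains the point
  supplies a lower bound by \<open>covariogram_lower_bound\<close>; \<open>layer_cake_bound\<close>
  merges these into one weighted integral.\<close>

lemma dilation_weight_le_covariogram: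
  "volume_n n K * (\<integral>\<^sup>+s. ennreal (real n * (1 - s) ^ (n - 1)) * indicator (dilation_graph K) (s, param m u t) \<partial>lborel) \<le>
    (\<integral>\<^sup>+y. indicator K (vec_ext n y) * indicator K (vec_ext n y + param m u t) \<partial>lebesgue_n n)"
proof -
  let ?E = "{s. (s, param m u t) \<in> dilation_graph K}"
  have "closed ?E"
    using closed_vimage[OF closed_dilation_graph[OF compact_K], of "\<lambda>s. (s, param m u t)"]
    by (simp add: vimage_def continuous_on_Pair continuous_on_id continuous_on_const)
  moreover have "?E \<subseteq> {0..1}" by (auto simp: dilation_graph_def)
  moreover have "volume_n n K * ennreal ((1 - s) ^ n) \<le>
      (\<integral>\<^sup>+y. indicator K (vec_ext n y) * indicator K (vec_ext n y + param m u t) \<partial>lebesgue_n n)"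
    if "s \<in> ?E" for s
  proof -
    obtain a b where "param m u t = s *\<^sub>R (a - b)" "a \<in> K" "b \<in> K" "0 \<le> s" "s \<le> 1"
      using \<open>s \<in> ?E\<close> by (auto simp: dilation_graph_def diff_body_def) blast
    then show ?thesis using covariogram_lower_bound[OF mn(2) K_Rn convex_K borel_K, of s a b] by simp
  qed
  ultimately have "volume_n n K * (\<integral>\<^sup>+s. ennreal (real n * (1 - s) ^ (n - 1)) * indicator ?E s \<partial>lborel) \<le>
    (\<integral>\<^sup>+y. indicator K (vec_ext n y) * indicator K (vec_ext n y + param m u t) \<partial>lebesgue_n n)"
    by (rule layer_cake_bound[OF mn(2)])
  then show ?thesis by (simp add: indicator_def)
qed

text \<open>The integral of the density times the covariogram is bounded below through the dilates
  of \<open>D\<close> and above through the translates of \<open>K\<close>; the volume of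
  \<open>K\<close> then cancels.\<close>

lemma param_measure_diff_body_le:
  "param_measure m \<phi> u (diff_body K) \<le>
    of_nat ((n + m) choose m) * (SUP y\<in>Rn n. param_measure m \<phi> u ((\<lambda>x. x - y) ` K))"
proof -
  interpret lm: product_sigma_finite "\<lambda>_::nat. lborel :: real measure" by standard
  interpret M: sigma_finite_measure "lebesgue_n m" by (rule lm.sigma_finite) simp
  interpret N: sigma_finite_measure "lebesgue_n n" by (rule lm.sigma_finite) simp
  interpret pr: pair_sigma_finite "lebesgue_n m" "lborel :: real measure" by standard
  interpret pn: pair_sigma_finite "lebesgue_n m" "lebesgue_n n" by standard
  let ?w = "\<lambda>s. ennreal (real n * (1 - s) ^ (n - 1))"
  let ?V = "volume_n n K" and ?D = "param_measure m \<phi> u (diff_body K)"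
  let ?S = "SUP y\<in>Rn n. param_measure m \<phi> u ((\<lambda>x. x - y) ` K)"
  let ?b = "ennreal (1 / real ((n + m) choose m))"
  let ?\<phi> = "\<lambda>t. ennreal (\<phi> (param m u t))"
  have m1: "(\<lambda>(t, s). ?w s * (?\<phi> t * indicator (dilation_graph K) (s, param m u t))) \<in> borel_measurable (lebesgue_n m \<Otimes>\<^sub>M lborel)"
    using measurable_dilation_graph by (simp add: case_prod_beta)
  have mt: "(\<lambda>s. ?w s * indicator (dilation_graph K) (s, param m u t)) \<in> borel_measurable lborel" if "t \<in> space (lebesgue_n m)" for t
    using measurable_compose[OF measurable_Pair1'[OF that] measurable_dilation_graph] by simp
  have ms: "(\<lambda>t. ?\<phi> t * indicator (dilation_graph K) (s, param m u t)) \<in> borel_measurable (lebesgue_n m)" for s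
    using measurable_compose[OF measurable_Pair2'[of s lborel] measurable_dilation_graph] by simp
  \<comment> \<open>Writing \<open>?b\<close> as the Beta integral brings in the factor
    \<open>s ^ m\<close> that matches the dilate at scale \<open>s\<close>.\<close>
  have "?b * ?D = (\<integral>\<^sup>+s. ?w s * ennreal (s ^ m) * indicator {0..1} s * ?D \<partial>lborel)"
    by (subst nn_integral_multc) (simp_all only: nn_integral_beta_binomial[OF mn(2)], measurable)
  also have "\<dots> \<le> (\<integral>\<^sup>+s. ?w s * (\<integral>\<^sup>+t. ?\<phi> t * indicator (dilation_graph K) (s, param m u t) \<partial>lebesgue_n m) \<partial>lborel)"
  proof (rule nn_integral_mono)
    fix s :: real
    show "?w s * ennreal (s ^ m) * indicator {0..1} s * ?D \<le>
        ?w s * (\<integral>\<^sup>+t. ?\<phi> t * indicator (dilation_graph K) (s, param m u t) \<partial>lebesgue_n m)"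
      using mult_left_mono[OF param_measure_dilate[of s], of "?w s"]
      by (auto simp: indicator_def mult.assoc)
  qed
  also have "\<dots> = (\<integral>\<^sup>+s. (\<integral>\<^sup>+t. ?w s * (?\<phi> t * indicator (dilation_graph K) (s, param m u t)) \<partial>lebesgue_n m) \<partial>lborel)"
    by (simp add: nn_integral_cmult ms)
  \<comment> \<open>Tonelli: with the section point fixed and \<open>s\<close> innermost, the
    weighted integral over scales can be compared with the covariogram.\<close>
  also have "\<dots> = (\<integral>\<^sup>+t. (\<integral>\<^sup>+s. ?w s * (?\<phi> t * indicator (dilation_graph K) (s, param m u t)) \<partial>lborel) \<partial>lebesgue_n m)"
    using pr.Fubini'[OF m1] .
  also have "\<dots> = (\<integral>\<^sup>+t. ?\<phi> t * (\<integral>\<^sup>+s. ?w s * indicator (dilation_graph K) (s, param m u t) \<partial>lborel) \<partial>lebesgue_n m)"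
    by (intro nn_integral_cong) (simp add: nn_integral_cmult[symmetric] mt mult.left_commute)
  finally have "?V * (?b * ?D) \<le>
      ?V * (\<integral>\<^sup>+t. ?\<phi> t * (\<integral>\<^sup>+s. ?w s * indicator (dilation_graph K) (s, param m u t) \<partial>lborel) \<partial>lebesgue_n m)"
    by (rule mult_left_mono) simp
  also have "\<dots> = (\<integral>\<^sup>+t. ?V * (?\<phi> t * (\<integral>\<^sup>+s. ?w s * indicator (dilation_graph K) (s, param m u t) \<partial>lborel)) \<partial>lebesgue_n m)"
  proof (rule nn_integral_cmult[symmetric])
    have "(\<lambda>(t, s). ?w s * indicator (dilation_graph K) (s, param m u t)) \<in> borel_measurable (lebesgue_n m \<Otimes>\<^sub>M lborel)"
      using measurable_dilation_graph by (simp add: case_prod_beta)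
    from lborel.borel_measurable_nn_integral[OF this]
    show "(\<lambda>t. ?\<phi> t * (\<integral>\<^sup>+s. ?w s * indicator (dilation_graph K) (s, param m u t) \<partial>lborel)) \<in> borel_measurable (lebesgue_n m)"
      by simp
  qed
  also have "\<dots> \<le> (\<integral>\<^sup>+t. ?\<phi> t *
      (\<integral>\<^sup>+y. indicator K (vec_ext n y) * indicator K (vec_ext n y + param m u t) \<partial>lebesgue_n n) \<partial>lebesgue_n m)"
    by (intro nn_integral_mono, subst mult.left_commute) (intro mult_left_mono dilation_weight_le_covariogram, simp)
  also have "\<dots> = (\<integral>\<^sup>+t. (\<integral>\<^sup>+y. indicator K (vec_ext n y) *
      (?\<phi> t * indicator K (vec_ext n y + param m u t)) \<partial>lebesgue_n n) \<partial>lebesgue_n m)"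
  proof (rule nn_integral_cong)
    fix t
    have [measurable]: "(\<lambda>y. vec_ext n y + param m u t) \<in> borel_measurable (lebesgue_n n)"
    proof (rule measurable_coordinatewise_then_product)
      show "(\<lambda>y. (vec_ext n y + param m u t) i) \<in> borel_measurable (lebesgue_n n)" for i
        using measurable_product_then_coordinatewise[OF measurable_vec_ext] by simp
    qed
    show "?\<phi> t * (\<integral>\<^sup>+y. indicator K (vec_ext n y) * indicator K (vec_ext n y + param m u t) \<partial>lebesgue_n n) =
      (\<integral>\<^sup>+y. indicator K (vec_ext n y) * (?\<phi> t * indicator K (vec_ext n y + param m u t)) \<partial>lebesgue_n n)"
      by (simp add: nn_integral_cmult[symmetric] mult.left_commute)
  qed
  \<comment> \<open>Tonelli again, now fixing the translation \<open>y\<close> and making the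
    section integral innermost.\<close>
  also have "\<dots> = (\<integral>\<^sup>+y. (\<integral>\<^sup>+t. indicator K (vec_ext n y) *
      (?\<phi> t * indicator K (vec_ext n y + param m u t)) \<partial>lebesgue_n m) \<partial>lebesgue_n n)"
  proof (rule pn.Fubini'[symmetric])
    have [measurable]: "(\<lambda>p. vec_ext n (snd p) + param m u (fst p)) \<in> borel_measurable (lebesgue_n m \<Otimes>\<^sub>M lebesgue_n n)"
    proof (rule measurable_coordinatewise_then_product)
      fix i
      have [measurable]: "(\<lambda>y. vec_ext n y i) \<in> borel_measurable (lebesgue_n n)"
        "(\<lambda>t. param m u t i) \<in> borel_measurable (lebesgue_n m)"
        using measurable_product_then_coordinatewise[OF measurable_vec_ext]
          measurable_product_then_coordinatewise[OF measurable_param] by auto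
      show "(\<lambda>p. (vec_ext n (snd p) + param m u (fst p)) i) \<in> borel_measurable (lebesgue_n m \<Otimes>\<^sub>M lebesgue_n n)"
        by simp
    qed
    have "(\<lambda>p. indicator K (vec_ext n (snd p)) * (?\<phi> (fst p) * indicator K (vec_ext n (snd p) + param m u (fst p))))
      \<in> borel_measurable (lebesgue_n m \<Otimes>\<^sub>M lebesgue_n n)" by measurable
    then show "(\<lambda>(t, y). indicator K (vec_ext n y) * (?\<phi> t * indicator K (vec_ext n y + param m u t)))
      \<in> borel_measurable (lebesgue_n m \<Otimes>\<^sub>M lebesgue_n n)" by (simp add: case_prod_beta)
  qed
  also have "\<dots> \<le> (\<integral>\<^sup>+y. indicator K (vec_ext n y) * ?S \<partial>lebesgue_n n)"
  proof (rule nn_integral_mono)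
    fix y
    \<comment> \<open>\<open>y + x\<close> lies in \<open>K\<close> exactly when \<open>x\<close>
      lies in \<open>K - y\<close>, so the inner integral is the section measure of a translate and
      is bounded by the supremum.\<close>
    have "indicator K (vec_ext n y + param m u t) = (indicator ((\<lambda>x. x - vec_ext n y) ` K) (param m u t) :: ennreal)" for t
      by (auto simp: indicator_def image_iff algebra_simps)
    then have "(\<integral>\<^sup>+t. ?\<phi> t * indicator K (vec_ext n y + param m u t) \<partial>lebesgue_n m) =
        param_measure m \<phi> u ((\<lambda>x. x - vec_ext n y) ` K)" by (simp add: param_measure_def)
    also have "\<dots> \<le> ?S" by (intro SUP_upper vec_ext_in_Rn)
    finally show "(\<integral>\<^sup>+t. indicator K (vec_ext n y) * (?\<phi> t * indicator K (vec_ext n y + param m u t)) \<partial>lebesgue_n m)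
      \<le> indicator K (vec_ext n y) * ?S"
      by (auto simp: indicator_def)
  qed
  also have "\<dots> = ?V * ?S"
    unfolding volume_n_def by (rule nn_integral_multc) measurable
  finally have "?V * (?b * ?D) \<le> ?V * ?S" .
  \<comment> \<open>Cancellation in the extended nonnegative reals requires a factor that is neither
    0 nor infinite.\<close>
  moreover have "0 < ?V" "?V < \<infinity>"
    using volume_n_pos K volume_n_compact_finite[OF compact_K] by (auto simp: convex_body_def)
  ultimately have "?b * ?D \<le> ?S" by (simp add: ennreal_mult_le_mult_iff)
  then have "of_nat ((n + m) choose m) * (?b * ?D) \<le> of_nat ((n + m) choose m) * ?S"
    by (rule mult_left_mono) simp
  moreover have "of_nat ((n + m) choose m) * ?b = 1"
    by (simp add: ennreal_of_nat_eq_real_of_nat flip: ennreal_mult)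
  ultimately show ?thesis by (simp flip: mult.assoc)
qed

end

section \<open>Return from coordinates to \<open>section_measure\<close>\<close>

text \<open>\<open>u\<close> is the very basis selected inside \<open>lebesgue_subspace\<close>.
  Integrating against the image measure amounts to composing with \<open>param\<close> once the
  integrand is Borel on \<open>H\<close>, whence the condition on \<open>A\<close>.\<close>

lemma section_measure_orthonormal_basis:
  assumes "H \<subseteq> Rn n" "subspace H" "0 < dim H"
    and meas: "\<phi> \<in> borel_measurable (restrict_space borel (Rn n))"
  obtains u where "\<And>i. i < dim H \<Longrightarrow> u i \<in> Rn n"
    "\<And>A. A \<in> sets borel \<Longrightarrow> section_measure n \<phi> H A = param_measure (dim H) \<phi> u A"
proof -
  define u where "u = (SOME u. orthonormal_basis_of n H u)"
  have "orthonormal_basis_of n H u"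
    unfolding u_def using orthonormal_basis_exists[OF assms(1-3)] by (rule someI_ex)
  then have u: "\<And>i. i < dim H \<Longrightarrow> u i \<in> Rn n" and sp: "span (u ` {..<dim H}) = H"
    by (auto simp: orthonormal_basis_of_def)
  have "section_measure n \<phi> H A = param_measure (dim H) \<phi> u A" if A: "A \<in> sets borel" for A
  proof -
    have L: "(\<lambda>t. \<Sum>i<dim H. t i *\<^sub>R u i) \<in> measurable (lebesgue_n (dim H)) (restrict_space borel H)"
    proof (rule measurable_restrict_space2)
      show "(\<lambda>t. \<Sum>i<dim H. t i *\<^sub>R u i) \<in> borel_measurable (lebesgue_n (dim H))"
        using measurable_param[of "dim H" u] by (simp add: param_def[abs_def])
      have "(\<Sum>i<dim H. t i *\<^sub>R u i) \<in> span (u ` {..<dim H})" for t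
        by (intro span_sum span_scale span_base) auto
      then show "(\<lambda>t. \<Sum>i<dim H. t i *\<^sub>R u i) \<in> space (lebesgue_n (dim H)) \<rightarrow> H"
        using sp by auto
    qed
    \<comment> \<open>The density is Borel on \<open>Rn n\<close>; composing with the inclusion of
      \<open>H\<close> makes it Borel on \<open>H\<close>.\<close>
    have "id \<in> measurable (restrict_space borel H) (restrict_space borel (Rn n))"
      using assms(1) by (intro measurable_restrict_space3) auto
    from measurable_compose[OF this meas]
    have [measurable]: "\<phi> \<in> borel_measurable (restrict_space borel H)" by simp
    have [measurable]: "indicator A \<in> borel_measurable (restrict_space borel H)"
      using A by (intro measurable_restrict_space1) simp
    show ?thesis
      unfolding section_measure_def lebesgue_subspace_def Let_def u_def[symmetric] param_measure_def param_def
      by (rule nn_integral_distr[OF L]) measurable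
  qed
  with u that show thesis by blast
qed

theorem theorem5:
  shows "\<exists>c::real. c > 1 \<and>
    (\<forall>(n::nat) (m::nat) (\<phi> :: (nat \<Rightarrow> real) \<Rightarrow> real) (H :: (nat \<Rightarrow> real) set) (K :: (nat \<Rightarrow> real) set).
      1 \<le> m \<and> m \<le> n \<and>
      (\<forall>x\<in>Rn n. 0 \<le> \<phi> x) \<and>
      \<phi> \<in> borel_measurable (restrict_space borel (Rn n)) \<and>
      radially_decreasing n \<phi> \<and>
      H \<subseteq> Rn n \<and> subspace H \<and> dim H = m \<and>
      convex_body n K \<longrightarrow>
      section_measure n \<phi> H {a - b | a b. a \<in> K \<and> b \<in> K}
        \<le> of_nat ((n + m) choose m) * (SUP y\<in>Rn n. section_measure n \<phi> H ((\<lambda>x. x - y) ` K)) \<and>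
      of_nat ((n + m) choose m) * (SUP y\<in>Rn n. section_measure n \<phi> H ((\<lambda>x. x - y) ` K))
        \<le> ennreal ((c * real n / real m) ^ m)
            * (SUP y\<in>Rn n. section_measure n \<phi> H ((\<lambda>x. x - y) ` K)))"
proof (intro exI[of _ "2 * exp 1"] conjI allI impI)
  show "1 < 2 * exp (1::real)" using exp_ge_add_one_self[of 1] by simp
next
  fix n m :: nat and \<phi> :: "(nat \<Rightarrow> real) \<Rightarrow> real" and H K :: "(nat \<Rightarrow> real) set"
  assume *: "1 \<le> m \<and> m \<le> n \<and>
      (\<forall>x\<in>Rn n. 0 \<le> \<phi> x) \<and>
      \<phi> \<in> borel_measurable (restrict_space borel (Rn n)) \<and>
      radially_decreasing n \<phi> \<and>
      H \<subseteq> Rn n \<and> subspace H \<and> dim H = m \<and>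
      convex_body n K"
  let ?S = "SUP y\<in>Rn n. section_measure n \<phi> H ((\<lambda>x. x - y) ` K)"
  have "of_nat ((n + m) choose m) \<le> ennreal ((2 * exp 1 * real n / real m) ^ m)"
    using binomial_le_linear_power[of m n] * by (simp add: ennreal_of_nat_eq_real_of_nat ennreal_leI)
  then show "of_nat ((n + m) choose m) * ?S \<le> ennreal ((2 * exp 1 * real n / real m) ^ m) * ?S"
    by (rule mult_right_mono) simp
  obtain u where u: "\<And>i. i < m \<Longrightarrow> u i \<in> Rn n"
    and sm: "\<And>A. A \<in> sets borel \<Longrightarrow> section_measure n \<phi> H A = param_measure m \<phi> u A"
    using section_measure_orthonormal_basis[of H n \<phi>] * by auto
  have K: "convex_body n K" "compact K"
    using * compactin_Euclidean_space(1) by (auto simp: convex_body_def)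
  \<comment> \<open>Translates of \<open>K\<close> are compact, hence Borel, so the coordinate
    formula applies to every member of the supremum.\<close>
  have "compact ((\<lambda>x. x - y) ` K)" for y
  proof (rule compact_continuous_image[OF continuous_on_coordinatewise_then_product K(2)])
    have "continuous_on K (\<lambda>x. x i - y i)" for i
      by (intro continuous_on_diff continuous_on_const
          continuous_on_product_then_coordinatewise[OF continuous_on_id])
    then show "continuous_on K (\<lambda>x. (x - y) i)" for i by simp
  qed
  then have "((\<lambda>x. x - y) ` K) \<in> sets borel" for y
    by (intro borel_closed compact_imp_closed)
  then have S: "?S = (SUP y\<in>Rn n. param_measure m \<phi> u ((\<lambda>x. x - y) ` K))"
    by (simp add: sm)
  have "section_measure n \<phi> H (diff_body K) = param_measure m \<phi> u (diff_body K)"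
    by (intro sm borel_closed compact_imp_closed compact_diff_body K(2))
  also have "\<dots> \<le> of_nat ((n + m) choose m) * ?S"
    unfolding S using * u by (intro param_measure_diff_body_le) auto
  finally show "section_measure n \<phi> H {a - b | a b. a \<in> K \<and> b \<in> K} \<le> of_nat ((n + m) choose m) * ?S"
    by (simp add: diff_body_def)
qed

end
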